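(* Let $\mathscr D$ be a duploid, $\mathscr C$ an (associative) category, and let $F:\mathscr C\rightharpoonup\mathscr D$, $G:\mathscr D\rightharpoonup\mathscr C$ form a positive adjunction ($F$ left adjoint, $G$ right adjoint). Then it induces a $\Downarrow$-relative coadjunction for the functor $\Downarrow:\mathscr N_l\to\mathscr P_t$: the functors $F:\mathscr C\to\mathscr P_t$ and $G:\mathscr N_l\to\mathscr C$ obtained by corestriction of $F$ and restriction of $G$ come with bijections $$\mathscr P_t(FC,\Downarrow N)\;\cong\;\mathscr C(C,GN)$$ natural in $C\in\mathscr C$ and $N\in\mathscr N_l$.
   Context: A non-associative category is a category without the associativity axiom. A bare functor $\mathscr D\rightharpoonup\mathscr E$ is a morphism of reflexive graphs (preserves identities but not necessarily composition). A morphism $f$ is thunkable if $(h\circ g)\circ f=h\circ(g\circ f)$ for all composable $g,h$; $h$ is linear if $(h\circ g)\circ f=h\circ(g\circ f)$ for all composable $f,g$. An object $A$ is positive if every morphism with source $A$ is linear, negative if every morphism with target $A$ is thunkable. An adjunction over non-associative categories $\mathscr D,\mathscr E$ consists of bare functors $F:\mathscr D\rightharpoonup\mathscr E$, $G:\mathscr E\rightharpoonup\mathscr D$ and bijections $\varphi_{A,B}:\mathscr E(FA,B)\cong\mathscr D(A,GB)$ with $\varphi(g\circ h)=Gg\circ\varphi(h)$ and $\varphi(h\circ Ff)=\varphi(h)\circ f$ for all composable $g,h,f$. It is positive when every $FA$ is positive, negative when every $GB$ is negative. A duploid is a non-associative category $\mathscr D$ in which every object is positive or negative (or both), and in which the identity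 functor $\mathscr D\to\mathscr D$ has a left adjoint $\Downarrow:\mathscr D\rightharpoonup\mathscr D$ with positive values and a right adjoint $\Uparrow:\mathscr D\rightharpoonup\mathscr D$ with negative values. $\mathscr P_t$ is the category of positive objects and thunkable morphisms of $\mathscr D$; $\mathscr N_l$ is the category of negative objects and linear morphisms of $\mathscr D$. $\Downarrow$ restricts to a functor $\mathscr N_l\to\mathscr P_t$, right adjoint to the restriction $\Uparrow:\mathscr P_t\to\mathscr N_l$. It is known that right adjoints preserve linear maps and their composition, and left adjoints preserve thunkable maps and their composition, and that the left adjoint of a positive adjunction from a category $\mathscr C$ is a functor that corestricts to $\mathscr C\to\mathscr P_t$. For a functor $R:\mathscr B\to\mathscr A$ between categories, an $R$-relative coadjunction consists of a category $\mathscr C$, functors $F:\mathscr C\to\mathscr A$, $G:\mathscr B\to\mathscr C$, and bijections $\mathscr A(FC,RB)\cong\mathscr C(C,GB)$ natural in $B$ and $C$. *)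

theory Defs
  imports Main
begin

record ('o, 'm) cat_data =
  Obj :: "'o set"
  Arr :: "'m set"
  Dom :: "'m \<Rightarrow> 'o"
  Cod :: "'m \<Rightarrow> 'o"
  ident :: "'o \<Rightarrow> 'm"
  comp :: "'m \<Rightarrow> 'm \<Rightarrow> 'm"  (infixl "\<cdot>\<index>" 70)

definition hom :: "('o, 'm) cat_data \<Rightarrow> 'o \<Rightarrow> 'o \<Rightarrow> 'm set" where
  "hom D A B = {f \<in> Arr D. Dom D f = A \<and> Cod D f = B}"

text \<open>Composition is in applicative order: \<open>g \<cdot>\<^bsub>D\<^esub> f\<close> is meaningful when
  the codomain of \<open>f\<close> is the domain of \<open>g\<close>.\<close>

locale nonassoc_category =
  fixes D :: "('o, 'm) cat_data"
  assumes Dom_Obj: "f \<in> Arr D \<Longrightarrow> Dom D f \<in> Obj D"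
    and Cod_Obj: "f \<in> Arr D \<Longrightarrow> Cod D f \<in> Obj D"
    and ident_hom: "A \<in> Obj D \<Longrightarrow> ident D A \<in> hom D A A"
    and comp_hom: "f \<in> hom D A B \<Longrightarrow> g \<in> hom D B C \<Longrightarrow> g \<cdot>\<^bsub>D\<^esub> f \<in> hom D A C"
    and comp_ident_left: "f \<in> hom D A B \<Longrightarrow> ident D B \<cdot>\<^bsub>D\<^esub> f = f"
    and comp_ident_right: "f \<in> hom D A B \<Longrightarrow> f \<cdot>\<^bsub>D\<^esub> ident D A = f"

locale category = nonassoc_category D for D :: "('o, 'm) cat_data" +
  assumes comp_assoc:
    "f \<in> hom D A B \<Longrightarrow> g \<in> hom D B C \<Longrightarrow> h \<in> hom D C E \<Longrightarrow>
      (h \<cdot>\<^bsub>D\<^esub> g) \<cdot>\<^bsub>D\<^esub> f = h \<cdot>\<^bsub>D\<^esub> (g \<cdot>\<^bsub>D\<^esub> f)"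

definition thunkable :: "('o, 'm) cat_data \<Rightarrow> 'm \<Rightarrow> bool" where
  "thunkable D f \<longleftrightarrow> f \<in> Arr D \<and>
    (\<forall>g \<in> Arr D. \<forall>h \<in> Arr D. Dom D g = Cod D f \<longrightarrow> Dom D h = Cod D g \<longrightarrow>
      (h \<cdot>\<^bsub>D\<^esub> g) \<cdot>\<^bsub>D\<^esub> f = h \<cdot>\<^bsub>D\<^esub> (g \<cdot>\<^bsub>D\<^esub> f))"

definition linear :: "('o, 'm) cat_data \<Rightarrow> 'm \<Rightarrow> bool" where
  "linear D h \<longleftrightarrow> h \<in> Arr D \<and>
    (\<forall>f \<in> Arr D. \<forall>g \<in> Arr D. Dom D g = Cod D f \<longrightarrow> Dom D h = Cod D g \<longrightarrow>
      (h \<cdot>\<^bsub>D\<^esub> g) \<cdot>\<^bsub>D\<^esub> f = h \<cdot>\<^bsub>D\<^esub> (g \<cdot>\<^bsub>D\<^esub> f))"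

definition positive :: "('o, 'm) cat_data \<Rightarrow> 'o \<Rightarrow> bool" where
  "positive D A \<longleftrightarrow> A \<in> Obj D \<and> (\<forall>h \<in> Arr D. Dom D h = A \<longrightarrow> linear D h)"

definition negative :: "('o, 'm) cat_data \<Rightarrow> 'o \<Rightarrow> bool" where
  "negative D A \<longleftrightarrow> A \<in> Obj D \<and> (\<forall>f \<in> Arr D. Cod D f = A \<longrightarrow> thunkable D f)"

definition positive_thunkable :: "('o, 'm) cat_data \<Rightarrow> ('o, 'm) cat_data"  ("\<P>\<^sub>t") where
  "\<P>\<^sub>t D = D\<lparr>Obj := {A. positive D A},
     Arr := {f. thunkable D f \<and> positive D (Dom D f) \<and> positive D (Cod D f)}\<rparr>"

definition negative_linear :: "('o, 'm) cat_data \<Rightarrow> ('o, 'm) cat_data"  ("\<N>\<^sub>l") where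
  "\<N>\<^sub>l D = D\<lparr>Obj := {A. negative D A},
     Arr := {f. linear D f \<and> negative D (Dom D f) \<and> negative D (Cod D f)}\<rparr>"

text \<open>The source and target of a map are not part of its data, so that restricting the source
  or the target leaves the data unchanged; values outside the source are irrelevant.\<close>

record ('o, 'm, 'p, 'n) graph_map =
  obj_map :: "'o \<Rightarrow> 'p"
  arr_map :: "'m \<Rightarrow> 'n"

definition id_map :: "('o, 'm, 'o, 'm) graph_map" where
  "id_map = \<lparr>obj_map = (\<lambda>A. A), arr_map = (\<lambda>f. f)\<rparr>"

locale bare_functor =
  D: nonassoc_category D + E: nonassoc_category E
  for D :: "('o, 'm) cat_data" and E :: "('p, 'n) cat_data"
    and F :: "('o, 'm, 'p, 'n) graph_map" +
  assumes obj_map_Obj: "A \<in> Obj D \<Longrightarrow> obj_map F A \<in> Obj E"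
    and arr_map_hom: "f \<in> hom D A B \<Longrightarrow> arr_map F f \<in> hom E (obj_map F A) (obj_map F B)"
    and arr_map_ident: "A \<in> Obj D \<Longrightarrow> arr_map F (ident D A) = ident E (obj_map F A)"

locale cat_functor =
  D: category D + E: category E + bare_functor D E F
  for D :: "('o, 'm) cat_data" and E :: "('p, 'n) cat_data"
    and F :: "('o, 'm, 'p, 'n) graph_map" +
  assumes arr_map_comp: "f \<in> hom D A B \<Longrightarrow> g \<in> hom D B C \<Longrightarrow>
      arr_map F (g \<cdot>\<^bsub>D\<^esub> f) = arr_map F g \<cdot>\<^bsub>E\<^esub> arr_map F f"

locale adjunction =
  F: bare_functor D E F + G: bare_functor E D G
  for D :: "('o, 'm) cat_data" and E :: "('p, 'n) cat_data"
    and F :: "('o, 'm, 'p, 'n) graph_map" and G :: "('p, 'n, 'o, 'm) graph_map" +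
  fixes \<phi> :: "'o \<Rightarrow> 'p \<Rightarrow> 'n \<Rightarrow> 'm"
  assumes bij: "A \<in> Obj D \<Longrightarrow> B \<in> Obj E \<Longrightarrow>
      bij_betw (\<phi> A B) (hom E (obj_map F A) B) (hom D A (obj_map G B))"
    and natural_target: "A \<in> Obj D \<Longrightarrow> h \<in> hom E (obj_map F A) B \<Longrightarrow> g \<in> hom E B B' \<Longrightarrow>
      \<phi> A B' (g \<cdot>\<^bsub>E\<^esub> h) = arr_map G g \<cdot>\<^bsub>D\<^esub> \<phi> A B h"
    and natural_source: "h \<in> hom E (obj_map F A) B \<Longrightarrow> f \<in> hom D A' A \<Longrightarrow>
      \<phi> A' B (h \<cdot>\<^bsub>E\<^esub> arr_map F f) = \<phi> A B h \<cdot>\<^bsub>D\<^esub> f"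

locale positive_adjunction = adjunction +
  assumes positive_values: "A \<in> Obj D \<Longrightarrow> positive E (obj_map F A)"

locale negative_adjunction = adjunction +
  assumes negative_values: "B \<in> Obj E \<Longrightarrow> negative D (obj_map G B)"

locale duploid =
  nonassoc_category D +
  down: positive_adjunction D D Down id_map \<delta> +
  up: negative_adjunction D D id_map Up \<upsilon>
  for D :: "('o, 'm) cat_data"
    and Down :: "('o, 'm, 'o, 'm) graph_map" and \<delta> :: "'o \<Rightarrow> 'o \<Rightarrow> 'm \<Rightarrow> 'm"
    and Up :: "('o, 'm, 'o, 'm) graph_map" and \<upsilon> :: "'o \<Rightarrow> 'o \<Rightarrow> 'm \<Rightarrow> 'm" +
  assumes polarised: "A \<in> Obj D \<Longrightarrow> positive D A \<or> negative D A"

locale relative_coadjunction =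
  R: cat_functor B A R + F: cat_functor C A F + G: cat_functor B C G
  for B :: "('bo, 'bm) cat_data" and A :: "('ao, 'am) cat_data"
    and R :: "('bo, 'bm, 'ao, 'am) graph_map"
    and C :: "('co, 'cm) cat_data"
    and F :: "('co, 'cm, 'ao, 'am) graph_map" and G :: "('bo, 'bm, 'co, 'cm) graph_map" +
  fixes \<psi> :: "'co \<Rightarrow> 'bo \<Rightarrow> 'am \<Rightarrow> 'cm"
  assumes bij: "X \<in> Obj C \<Longrightarrow> Y \<in> Obj B \<Longrightarrow>
      bij_betw (\<psi> X Y) (hom A (obj_map F X) (obj_map R Y)) (hom C X (obj_map G Y))"
    and natural_target: "X \<in> Obj C \<Longrightarrow> Y \<in> Obj B \<Longrightarrow>
      f \<in> hom A (obj_map F X) (obj_map R Y) \<Longrightarrow> v \<in> hom B Y Y' \<Longrightarrow>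
      \<psi> X Y' (arr_map R v \<cdot>\<^bsub>A\<^esub> f) = arr_map G v \<cdot>\<^bsub>C\<^esub> \<psi> X Y f"
    and natural_source: "X \<in> Obj C \<Longrightarrow> Y \<in> Obj B \<Longrightarrow>
      f \<in> hom A (obj_map F X) (obj_map R Y) \<Longrightarrow> u \<in> hom C X' X \<Longrightarrow>
      \<psi> X' Y (f \<cdot>\<^bsub>A\<^esub> arr_map F u) = \<psi> X Y f \<cdot>\<^bsub>C\<^esub> u"

end

theory Submission
  imports Defs
begin

text \<open>The unit \<open>u\<^sub>A : A \<rightarrow> \<Down>A\<close> of the adjunction defining \<open>\<Down>\<close> is invertible, with inverse the counit
  \<open>e\<^sub>A\<close>, and \<open>u\<^sub>A\<close> is thunkable. If \<open>N\<close> is negative, \<open>e\<^sub>N\<close> and all maps into \<open>N\<close> are thunkable, so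
  composition with \<open>e\<^sub>N\<close> identifies the thunkable maps into \<open>\<Down>N\<close> with all maps into \<open>N\<close>. Hence
  \<open>f \<mapsto> \<phi>(e\<^sub>N \<circ> f)\<close> is the required bijection.\<close>

section \<open>Thunkable and linear maps in terms of hom-sets\<close>

lemma thunkable_assoc:
  assumes "thunkable D f" "f \<in> hom D A B" "g \<in> hom D B X" "h \<in> hom D X Y"
  shows "(h \<cdot>\<^bsub>D\<^esub> g) \<cdot>\<^bsub>D\<^esub> f = h \<cdot>\<^bsub>D\<^esub> (g \<cdot>\<^bsub>D\<^esub> f)"
  using assms unfolding thunkable_def hom_def by simp

lemma linear_assoc:
  assumes "linear D h" "f \<in> hom D A B" "g \<in> hom D B X" "h \<in> hom D X Y"
  shows "(h \<cdot>\<^bsub>D\<^esub> g) \<cdot>\<^bsub>D\<^esub> f = h \<cdot>\<^bsub>D\<^esub> (g \<cdot>\<^bsub>D\<^esub> f)"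
  using assms unfolding linear_def hom_def by simp

lemma thunkableI:
  assumes "f \<in> hom D A B"
    and "\<And>g h X Y. g \<in> hom D B X \<Longrightarrow> h \<in> hom D X Y \<Longrightarrow>
      (h \<cdot>\<^bsub>D\<^esub> g) \<cdot>\<^bsub>D\<^esub> f = h \<cdot>\<^bsub>D\<^esub> (g \<cdot>\<^bsub>D\<^esub> f)"
  shows "thunkable D f"
  using assms unfolding thunkable_def hom_def by simp

lemma linearI:
  assumes "h \<in> hom D X Y"
    and "\<And>f g A B. f \<in> hom D A B \<Longrightarrow> g \<in> hom D B X \<Longrightarrow>
      (h \<cdot>\<^bsub>D\<^esub> g) \<cdot>\<^bsub>D\<^esub> f = h \<cdot>\<^bsub>D\<^esub> (g \<cdot>\<^bsub>D\<^esub> f)"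
  shows "linear D h"
  using assms unfolding linear_def hom_def by simp

lemma negative_thunkable: "negative D B \<Longrightarrow> f \<in> hom D A B \<Longrightarrow> thunkable D f"
  unfolding negative_def hom_def by simp

lemma hom_positive_thunkable:
  "f \<in> hom (\<P>\<^sub>t D) A B \<longleftrightarrow> f \<in> hom D A B \<and> thunkable D f \<and> positive D A \<and> positive D B"
  by (auto simp: positive_thunkable_def hom_def thunkable_def)

lemma hom_negative_linear:
  "f \<in> hom (\<N>\<^sub>l D) A B \<longleftrightarrow> f \<in> hom D A B \<and> linear D f \<and> negative D A \<and> negative D B"
  by (auto simp: negative_linear_def hom_def linear_def)

lemma positive_thunkable_simps [simp]:
  "comp (\<P>\<^sub>t D) = comp D" "ident (\<P>\<^sub>t D) = ident D" "A \<in> Obj (\<P>\<^sub>t D) \<longleftrightarrow> positive D A"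
  by (simp_all add: positive_thunkable_def)

lemma negative_linear_simps [simp]:
  "comp (\<N>\<^sub>l D) = comp D" "ident (\<N>\<^sub>l D) = ident D" "A \<in> Obj (\<N>\<^sub>l D) \<longleftrightarrow> negative D A"
  by (simp_all add: negative_linear_def)

lemma positive_Obj: "positive D A \<Longrightarrow> A \<in> Obj D"
  by (simp add: positive_def)

lemma negative_Obj: "negative D A \<Longrightarrow> A \<in> Obj D"
  by (simp add: negative_def)

section \<open>The categories \<open>\<P>\<^sub>t D\<close> and
  \<open>\<N>\<^sub>l D\<close>\<close>

context nonassoc_category
begin

lemma hom_Obj: "f \<in> hom D A B \<Longrightarrow> A \<in> Obj D \<and> B \<in> Obj D"
  using Dom_Obj Cod_Obj by (auto simp: hom_def)

lemma thunkable_ident: "A \<in> Obj D \<Longrightarrow> thunkable D (ident D A)"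
  by (rule thunkableI[OF ident_hom]) (metis comp_hom comp_ident_right)+

lemma linear_ident: "A \<in> Obj D \<Longrightarrow> linear D (ident D A)"
  by (rule linearI[OF ident_hom]) (metis comp_hom comp_ident_left)+

text \<open>Of the five sides of the associativity pentagon for \<open>k\<close>, \<open>h\<close>,
  \<open>g\<close>, \<open>f\<close>, four are instances of thunkability of \<open>f\<close> or
  \<open>g\<close>; the remaining side is the claim.\<close>

lemma thunkable_comp:
  assumes f: "thunkable D f" "f \<in> hom D A B" and g: "thunkable D g" "g \<in> hom D B X"
  shows "thunkable D (g \<cdot>\<^bsub>D\<^esub> f)"
proof (rule thunkableI)
  show "g \<cdot>\<^bsub>D\<^esub> f \<in> hom D A X" using f g comp_hom by blast
  fix h k Y Z assume h: "h \<in> hom D X Y" and k: "k \<in> hom D Y Z"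
  have "(k \<cdot>\<^bsub>D\<^esub> h) \<cdot>\<^bsub>D\<^esub> (g \<cdot>\<^bsub>D\<^esub> f) = ((k \<cdot>\<^bsub>D\<^esub> h) \<cdot>\<^bsub>D\<^esub> g) \<cdot>\<^bsub>D\<^esub> f"
    by (rule thunkable_assoc[OF f g(2) comp_hom[OF h k], symmetric])
  also have "\<dots> = (k \<cdot>\<^bsub>D\<^esub> (h \<cdot>\<^bsub>D\<^esub> g)) \<cdot>\<^bsub>D\<^esub> f"
    by (simp add: thunkable_assoc[OF g h k])
  also have "\<dots> = k \<cdot>\<^bsub>D\<^esub> ((h \<cdot>\<^bsub>D\<^esub> g) \<cdot>\<^bsub>D\<^esub> f)"
    by (rule thunkable_assoc[OF f comp_hom[OF g(2) h] k])
  also have "\<dots> = k \<cdot>\<^bsub>D\<^esub> (h \<cdot>\<^bsub>D\<^esub> (g \<cdot>\<^bsub>D\<^esub> f))"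
    by (simp add: thunkable_assoc[OF f g(2) h])
  finally show "(k \<cdot>\<^bsub>D\<^esub> h) \<cdot>\<^bsub>D\<^esub> (g \<cdot>\<^bsub>D\<^esub> f) = k \<cdot>\<^bsub>D\<^esub> (h \<cdot>\<^bsub>D\<^esub> (g \<cdot>\<^bsub>D\<^esub> f))" .
qed

text \<open>The same pentagon, with four sides now given by linearity of \<open>k\<close> or
  \<open>h\<close>.\<close>

lemma linear_comp:
  assumes h: "linear D h" "h \<in> hom D X Y" and k: "linear D k" "k \<in> hom D Y Z"
  shows "linear D (k \<cdot>\<^bsub>D\<^esub> h)"
proof (rule linearI)
  show "k \<cdot>\<^bsub>D\<^esub> h \<in> hom D X Z" using h k comp_hom by blast
  fix f g A B assume f: "f \<in> hom D A B" and g: "g \<in> hom D B X"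
  have "((k \<cdot>\<^bsub>D\<^esub> h) \<cdot>\<^bsub>D\<^esub> g) \<cdot>\<^bsub>D\<^esub> f = (k \<cdot>\<^bsub>D\<^esub> (h \<cdot>\<^bsub>D\<^esub> g)) \<cdot>\<^bsub>D\<^esub> f"
    by (simp add: linear_assoc[OF k(1) g h(2) k(2)])
  also have "\<dots> = k \<cdot>\<^bsub>D\<^esub> ((h \<cdot>\<^bsub>D\<^esub> g) \<cdot>\<^bsub>D\<^esub> f)"
    by (rule linear_assoc[OF k(1) f comp_hom[OF g h(2)] k(2)])
  also have "\<dots> = k \<cdot>\<^bsub>D\<^esub> (h \<cdot>\<^bsub>D\<^esub> (g \<cdot>\<^bsub>D\<^esub> f))"
    by (simp add: linear_assoc[OF h(1) f g h(2)])
  also have "\<dots> = (k \<cdot>\<^bsub>D\<^esub> h) \<cdot>\<^bsub>D\<^esub> (g \<cdot>\<^bsub>D\<^esub> f)"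
    by (rule linear_assoc[OF k(1) comp_hom[OF f g] h(2) k(2), symmetric])
  finally show "((k \<cdot>\<^bsub>D\<^esub> h) \<cdot>\<^bsub>D\<^esub> g) \<cdot>\<^bsub>D\<^esub> f = (k \<cdot>\<^bsub>D\<^esub> h) \<cdot>\<^bsub>D\<^esub> (g \<cdot>\<^bsub>D\<^esub> f)" .
qed

text \<open>Associativity is thunkability of the rightmost factor; for \<open>\<N>\<^sub>l D\<close>
  below it is linearity of the leftmost one.\<close>

lemma category_positive_thunkable: "category (\<P>\<^sub>t D)"
proof unfold_locales
  fix f assume "f \<in> Arr (\<P>\<^sub>t D)"
  then show "Dom (\<P>\<^sub>t D) f \<in> Obj (\<P>\<^sub>t D)" "Cod (\<P>\<^sub>t D) f \<in> Obj (\<P>\<^sub>t D)"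
    by (simp_all add: positive_thunkable_def)
qed (auto simp: hom_positive_thunkable ident_hom comp_hom comp_ident_left comp_ident_right
    thunkable_ident thunkable_comp positive_Obj thunkable_assoc)

lemma category_negative_linear: "category (\<N>\<^sub>l D)"
proof unfold_locales
  fix f assume "f \<in> Arr (\<N>\<^sub>l D)"
  then show "Dom (\<N>\<^sub>l D) f \<in> Obj (\<N>\<^sub>l D)" "Cod (\<N>\<^sub>l D) f \<in> Obj (\<N>\<^sub>l D)"
    by (simp_all add: negative_linear_def)
qed (auto simp: hom_negative_linear ident_hom comp_hom comp_ident_left comp_ident_right
    linear_ident linear_comp negative_Obj linear_assoc)

end

section \<open>Transposition in an adjunction of bare functors\<close>

context adjunction
begin

lemma \<phi>_hom: "A \<in> Obj D \<Longrightarrow> h \<in> hom E (obj_map F A) B \<Longrightarrow> \<phi> A B h \<in> hom D A (obj_map G B)"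
  using bij[of A B] F.E.hom_Obj by (meson bij_betwE)

lemma \<phi>_inj:
  assumes "A \<in> Obj D" "h \<in> hom E (obj_map F A) B" "h' \<in> hom E (obj_map F A) B"
    and "\<phi> A B h = \<phi> A B h'"
  shows "h = h'"
  using assms bij[of A B] F.E.hom_Obj[OF assms(2)] by (meson bij_betw_imp_inj_on inj_onD)

lemma \<phi>_surj:
  assumes "A \<in> Obj D" "B \<in> Obj E" "k \<in> hom D A (obj_map G B)"
  obtains h where "h \<in> hom E (obj_map F A) B" "\<phi> A B h = k"
  using bij[OF assms(1,2)] assms(3) by (metis bij_betw_imp_surj_on imageE)

text \<open>Source naturality at the identity of \<open>obj_map F A\<close>: the transpose of
  \<open>arr_map F f\<close> is the unit of the adjunction at \<open>A\<close> composed with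
  \<open>f\<close>.\<close>

lemma \<phi>_arr_map:
  assumes f: "f \<in> hom D A' A"
  shows "\<phi> A' (obj_map F A) (arr_map F f) =
    \<phi> A (obj_map F A) (ident E (obj_map F A)) \<cdot>\<^bsub>D\<^esub> f"
  using natural_source[OF F.E.ident_hom f] F.E.comp_ident_left[OF F.arr_map_hom[OF f]]
    F.obj_map_Obj F.D.hom_Obj[OF f] by metis

end

section \<open>Adjunctions whose left adjoint starts from a category\<close>

locale category_adjunction = adjunction D E F G \<phi> + D: category D
  for D :: "('o, 'm) cat_data" and E :: "('p, 'n) cat_data"
    and F :: "('o, 'm, 'p, 'n) graph_map" and G :: "('p, 'n, 'o, 'm) graph_map"
    and \<phi> :: "'o \<Rightarrow> 'p \<Rightarrow> 'n \<Rightarrow> 'm"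
begin

text \<open>The two naturality laws turn the two bracketings in \<open>E\<close> into the two
  bracketings of \<open>arr_map G k\<close>, the transpose of \<open>h\<close>, and \<open>f\<close>
  in \<open>D\<close>. These agree because \<open>D\<close> is associative, and
  \<open>\<phi>\<close> is injective.\<close>

lemma left_adjoint_thunkable:
  assumes f: "f \<in> hom D A' A"
  shows "thunkable E (arr_map F f)"
proof (rule thunkableI[OF F.arr_map_hom[OF f]])
  fix h k X Y assume h: "h \<in> hom E (obj_map F A) X" and k: "k \<in> hom E X Y"
  have Obj: "A' \<in> Obj D" "A \<in> Obj D" using F.D.hom_Obj[OF f] by auto
  note Ff = F.arr_map_hom[OF f]
  have "\<phi> A' Y ((k \<cdot>\<^bsub>E\<^esub> h) \<cdot>\<^bsub>E\<^esub> arr_map F f) = (arr_map G k \<cdot>\<^bsub>D\<^esub> \<phi> A X h) \<cdot>\<^bsub>D\<^esub> f"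
    by (simp add: natural_source[OF F.E.comp_hom[OF h k] f] natural_target[OF Obj(2) h k])
  also have "\<dots> = arr_map G k \<cdot>\<^bsub>D\<^esub> (\<phi> A X h \<cdot>\<^bsub>D\<^esub> f)"
    by (rule D.comp_assoc[OF f \<phi>_hom[OF Obj(2) h] G.arr_map_hom[OF k]])
  also have "\<dots> = \<phi> A' Y (k \<cdot>\<^bsub>E\<^esub> (h \<cdot>\<^bsub>E\<^esub> arr_map F f))"
    by (simp add: natural_source[OF h f] natural_target[OF Obj(1) F.E.comp_hom[OF Ff h] k])
  finally show "(k \<cdot>\<^bsub>E\<^esub> h) \<cdot>\<^bsub>E\<^esub> arr_map F f = k \<cdot>\<^bsub>E\<^esub> (h \<cdot>\<^bsub>E\<^esub> arr_map F f)"
    using \<phi>_inj[OF Obj(1)] F.E.comp_hom Ff h k by meson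
qed

text \<open>Both sides have the unit \<open>\<eta>\<close> at \<open>X\<close> followed through
  \<open>g\<close> and \<open>f\<close> as transpose, up to bracketing in the associative
  \<open>D\<close>.\<close>

lemma left_adjoint_comp:
  assumes f: "f \<in> hom D A B" and g: "g \<in> hom D B X"
  shows "arr_map F (g \<cdot>\<^bsub>D\<^esub> f) = arr_map F g \<cdot>\<^bsub>E\<^esub> arr_map F f"
proof -
  have Obj: "A \<in> Obj D" "X \<in> Obj D" using F.D.hom_Obj f g by blast+
  note Ff = F.arr_map_hom[OF f] and Fg = F.arr_map_hom[OF g]
  define \<eta> where "\<eta> = \<phi> X (obj_map F X) (ident E (obj_map F X))"
  have \<eta>: "\<eta> \<in> hom D X (obj_map G (obj_map F X))"
    unfolding \<eta>_def by (intro \<phi>_hom F.E.ident_hom F.obj_map_Obj Obj)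
  have "\<phi> A (obj_map F X) (arr_map F g \<cdot>\<^bsub>E\<^esub> arr_map F f) = (\<eta> \<cdot>\<^bsub>D\<^esub> g) \<cdot>\<^bsub>D\<^esub> f"
    by (simp add: natural_source[OF Fg f] \<phi>_arr_map[OF g] \<eta>_def)
  also have "\<dots> = \<eta> \<cdot>\<^bsub>D\<^esub> (g \<cdot>\<^bsub>D\<^esub> f)" by (rule D.comp_assoc[OF f g \<eta>])
  also have "\<dots> = \<phi> A (obj_map F X) (arr_map F (g \<cdot>\<^bsub>D\<^esub> f))"
    by (simp add: \<phi>_arr_map[OF F.D.comp_hom[OF f g]] \<eta>_def)
  finally show ?thesis
    using \<phi>_inj[OF Obj(1)] F.E.comp_hom[OF Ff Fg] F.arr_map_hom[OF F.D.comp_hom[OF f g]]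
    by metis
qed

text \<open>Since \<open>arr_map G k\<close> is the transpose of \<open>k\<close> composed with the
  counit, the claim reduces to moving a bracket in \<open>g\<close>, \<open>f\<close>, counit, which
  linearity of \<open>g\<close> permits.\<close>

lemma right_adjoint_comp_linear:
  assumes f: "f \<in> hom E A B" and g: "g \<in> hom E B X" "linear E g"
  shows "arr_map G (g \<cdot>\<^bsub>E\<^esub> f) = arr_map G g \<cdot>\<^bsub>D\<^esub> arr_map G f"
proof -
  have A: "A \<in> Obj E" "obj_map G A \<in> Obj D"
    using F.E.hom_Obj[OF f] G.obj_map_Obj by auto
  \<comment> \<open>The counit at \<open>A\<close>: the map whose transpose is the identity of
    \<open>obj_map G A\<close>.\<close>
  obtain \<epsilon> where \<epsilon>: "\<epsilon> \<in> hom E (obj_map F (obj_map G A)) A"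
    "\<phi> (obj_map G A) A \<epsilon> = ident D (obj_map G A)"
    using \<phi>_surj[OF A(2,1) F.D.ident_hom[OF A(2)]] by blast
  have 1: "\<phi> (obj_map G A) Y (k \<cdot>\<^bsub>E\<^esub> \<epsilon>) = arr_map G k" if "k \<in> hom E A Y" for k Y
    using natural_target[OF A(2) \<epsilon>(1) that] \<epsilon>(2) F.D.comp_ident_right[OF G.arr_map_hom[OF that]]
    by simp
  have "arr_map G (g \<cdot>\<^bsub>E\<^esub> f) = \<phi> (obj_map G A) X ((g \<cdot>\<^bsub>E\<^esub> f) \<cdot>\<^bsub>E\<^esub> \<epsilon>)"
    by (rule 1[OF F.E.comp_hom[OF f g(1)], symmetric])
  also have "\<dots> = \<phi> (obj_map G A) X (g \<cdot>\<^bsub>E\<^esub> (f \<cdot>\<^bsub>E\<^esub> \<epsilon>))"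
    by (simp add: linear_assoc[OF g(2) \<epsilon>(1) f g(1)])
  also have "\<dots> = arr_map G g \<cdot>\<^bsub>D\<^esub> arr_map G f"
    by (simp add: natural_target[OF A(2) F.E.comp_hom[OF \<epsilon>(1) f] g(1)] 1[OF f])
  finally show ?thesis .
qed

lemma right_adjoint_functor: "cat_functor (\<N>\<^sub>l E) D G"
proof -
  interpret N: category "\<N>\<^sub>l E" by (rule F.E.category_negative_linear)
  show ?thesis
    by unfold_locales
      (auto simp: hom_negative_linear negative_Obj G.obj_map_Obj G.arr_map_ident
        intro: G.arr_map_hom right_adjoint_comp_linear)
qed

text \<open>Images of objects are positive by hypothesis, and images of arrows are thunkable because
  \<open>D\<close> is associative.\<close>

lemma left_adjoint_functor:
  assumes "positive_adjunction D E F G \<phi>"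
  shows "cat_functor D (\<P>\<^sub>t E) F"
proof -
  interpret positive_adjunction D E F G \<phi> by (rule assms)
  interpret P: category "\<P>\<^sub>t E" by (rule F.E.category_positive_thunkable)
  show ?thesis
    by unfold_locales
      (auto simp: hom_positive_thunkable positive_values F.arr_map_ident F.arr_map_hom
        left_adjoint_thunkable left_adjoint_comp dest: F.D.hom_Obj)
qed

end

section \<open>The unit and counit of \<Down>, and the functor they induce\<close>

context duploid
begin

definition unit :: "'o \<Rightarrow> 'm" where
  "unit A = \<delta> A (obj_map Down A) (ident D (obj_map Down A))"

text \<open>The right adjoint is the identity, so the counit at \<open>A\<close> is the preimage of
  the identity of \<open>A\<close> itself under the bijection \<open>\<delta> A A\<close>.\<close>

definition counit :: "'o \<Rightarrow> 'm" where
  "counit A = the_inv_into (hom D (obj_map Down A) A) (\<delta> A A) (ident D A)"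

lemma unit_hom: "A \<in> Obj D \<Longrightarrow> unit A \<in> hom D A (obj_map Down A)"
  unfolding unit_def
  using down.\<phi>_hom[OF _ ident_hom[OF down.F.obj_map_Obj]] by (simp add: id_map_def)

text \<open>Target naturality at an identity, with the identity as right adjoint. From here on
  \<delta> is handled as precomposition with the unit.\<close>

lemma \<delta>_eq_comp_unit:
  assumes "A \<in> Obj D" "h \<in> hom D (obj_map Down A) B"
  shows "\<delta> A B h = h \<cdot>\<^bsub>D\<^esub> unit A"
  using down.natural_target[OF assms(1) ident_hom[OF down.F.obj_map_Obj[OF assms(1)]] assms(2)]
    comp_ident_right[OF assms(2)] by (simp add: id_map_def unit_def)

text \<open>Target naturality says that \<delta> commutes with postcomposition; for a \<delta> that
  precomposes with the unit, this is exactly thunkability of the unit.\<close>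

lemma unit_thunkable:
  assumes A: "A \<in> Obj D"
  shows "thunkable D (unit A)"
proof (rule thunkableI[OF unit_hom[OF A]])
  fix g h X Y assume g: "g \<in> hom D (obj_map Down A) X" and h: "h \<in> hom D X Y"
  show "(h \<cdot>\<^bsub>D\<^esub> g) \<cdot>\<^bsub>D\<^esub> unit A = h \<cdot>\<^bsub>D\<^esub> (g \<cdot>\<^bsub>D\<^esub> unit A)"
    using down.natural_target[OF A g h] \<delta>_eq_comp_unit[OF A] g comp_hom[OF g h]
    by (simp add: id_map_def)
qed

text \<open>Injectivity of \<delta>. Equations between maps out of \<open>obj_map Down A\<close> are
  proved below by cancelling the unit on the right.\<close>

lemma comp_unit_inj:
  assumes "A \<in> Obj D" "h \<in> hom D (obj_map Down A) B" "h' \<in> hom D (obj_map Down A) B"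
    and "h \<cdot>\<^bsub>D\<^esub> unit A = h' \<cdot>\<^bsub>D\<^esub> unit A"
  shows "h = h'"
  using down.\<phi>_inj[OF assms(1-3)] assms by (simp add: \<delta>_eq_comp_unit)

lemma counit:
  assumes A: "A \<in> Obj D"
  shows counit_hom: "counit A \<in> hom D (obj_map Down A) A"
    and counit_unit: "counit A \<cdot>\<^bsub>D\<^esub> unit A = ident D A"
proof -
  have bij: "bij_betw (\<delta> A A) (hom D (obj_map Down A) A) (hom D A A)"
    using down.bij[OF A A] by (simp add: id_map_def)
  show hom: "counit A \<in> hom D (obj_map Down A) A"
    unfolding counit_def
    by (rule bij_betwE[OF bij_betw_the_inv_into[OF bij], rule_format, OF ident_hom[OF A]])
  have "\<delta> A A (counit A) = ident D A"
    unfolding counit_def by (rule f_the_inv_into_f_bij_betw[OF bij]) (simp add: ident_hom[OF A])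
  then show "counit A \<cdot>\<^bsub>D\<^esub> unit A = ident D A"
    using \<delta>_eq_comp_unit[OF A hom] by simp
qed

text \<open>After precomposition with the unit, thunkability of the unit exposes the known composite
  \<open>counit_unit\<close>.\<close>

lemma unit_counit:
  assumes A: "A \<in> Obj D"
  shows "unit A \<cdot>\<^bsub>D\<^esub> counit A = ident D (obj_map Down A)"
proof (rule comp_unit_inj[OF A])
  note u = unit_hom[OF A] and e = counit_hom[OF A]
  show "unit A \<cdot>\<^bsub>D\<^esub> counit A \<in> hom D (obj_map Down A) (obj_map Down A)"
    by (rule comp_hom[OF e u])
  show "ident D (obj_map Down A) \<in> hom D (obj_map Down A) (obj_map Down A)"
    by (rule ident_hom[OF down.F.obj_map_Obj[OF A]])
  show "(unit A \<cdot>\<^bsub>D\<^esub> counit A) \<cdot>\<^bsub>D\<^esub> unit A = ident D (obj_map Down A) \<cdot>\<^bsub>D\<^esub> unit A"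
    using thunkable_assoc[OF unit_thunkable[OF A] u e u] counit_unit[OF A]
      comp_ident_right[OF u] comp_ident_left[OF u] by simp
qed

text \<open>Source naturality of \<delta> rewritten with the unit; it moves
  \<open>arr_map Down f\<close> across the unit while keeping brackets to the left.\<close>

lemma comp_Down_comp_unit:
  assumes f: "f \<in> hom D A B" and h: "h \<in> hom D (obj_map Down B) X"
  shows "(h \<cdot>\<^bsub>D\<^esub> arr_map Down f) \<cdot>\<^bsub>D\<^esub> unit A = (h \<cdot>\<^bsub>D\<^esub> unit B) \<cdot>\<^bsub>D\<^esub> f"
  using down.natural_source[OF h f] comp_hom[OF down.F.arr_map_hom[OF f] h] hom_Obj[OF f] h
  by (simp add: \<delta>_eq_comp_unit)

lemma unit_natural:
  assumes f: "f \<in> hom D A B"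
  shows "arr_map Down f \<cdot>\<^bsub>D\<^esub> unit A = unit B \<cdot>\<^bsub>D\<^esub> f"
  using down.\<phi>_arr_map[OF f] \<delta>_eq_comp_unit[OF _ down.F.arr_map_hom[OF f]] hom_Obj[OF f]
  by (simp add: unit_def)

text \<open>\<Down> acts on arrows by conjugation with the invertible unit. This writes
  \<open>arr_map Down f\<close> as a composite whose factors can be tested for thunkability.\<close>

lemma Down_eq:
  assumes f: "f \<in> hom D A B"
  shows "arr_map Down f = (unit B \<cdot>\<^bsub>D\<^esub> f) \<cdot>\<^bsub>D\<^esub> counit A"
proof -
  have A: "A \<in> Obj D" and B: "B \<in> Obj D" using hom_Obj[OF f] by auto
  note uf = comp_hom[OF f unit_hom[OF B]]
  show ?thesis
  proof (rule comp_unit_inj[OF A down.F.arr_map_hom[OF f] comp_hom[OF counit_hom[OF A] uf]])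
    show "arr_map Down f \<cdot>\<^bsub>D\<^esub> unit A = ((unit B \<cdot>\<^bsub>D\<^esub> f) \<cdot>\<^bsub>D\<^esub> counit A) \<cdot>\<^bsub>D\<^esub> unit A"
      using thunkable_assoc[OF unit_thunkable[OF A] unit_hom[OF A] counit_hom[OF A] uf]
      by (simp add: unit_natural[OF f] counit_unit[OF A] comp_ident_right[OF uf])
  qed
qed

text \<open>In the conjugation formula the counit and \<open>f\<close> have negative targets, and
  the unit is always thunkable.\<close>

lemma Down_thunkable:
  assumes "negative D A" "negative D B" and f: "f \<in> hom D A B"
  shows "thunkable D (arr_map Down f)"
proof -
  have A: "A \<in> Obj D" and B: "B \<in> Obj D" using hom_Obj[OF f] by auto
  show ?thesis
    unfolding Down_eq[OF f]
    by (rule thunkable_comp[OF negative_thunkable[OF assms(1) counit_hom[OF A]] counit_hom[OF A]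
          thunkable_comp[OF negative_thunkable[OF assms(2) f] f unit_thunkable[OF B] unit_hom[OF B]]
          comp_hom[OF f unit_hom[OF B]]])
qed

text \<open>Cancelling the unit at \<open>A\<close> leaves a rebracketing of the unit at
  \<open>X\<close>, \<open>g\<close> and \<open>f\<close>, which is thunkability of
  \<open>f\<close>.\<close>

lemma Down_comp:
  assumes f: "f \<in> hom D A B" "thunkable D f" and g: "g \<in> hom D B X"
  shows "arr_map Down (g \<cdot>\<^bsub>D\<^esub> f) = arr_map Down g \<cdot>\<^bsub>D\<^esub> arr_map Down f"
proof (rule comp_unit_inj)
  have X: "X \<in> Obj D" using hom_Obj[OF g] by auto
  show "A \<in> Obj D" using hom_Obj[OF f(1)] by auto
  note gf = comp_hom[OF f(1) g]
  show "arr_map Down (g \<cdot>\<^bsub>D\<^esub> f) \<in> hom D (obj_map Down A) (obj_map Down X)"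
    by (rule down.F.arr_map_hom[OF gf])
  show "arr_map Down g \<cdot>\<^bsub>D\<^esub> arr_map Down f \<in> hom D (obj_map Down A) (obj_map Down X)"
    by (intro comp_hom[OF down.F.arr_map_hom[OF f(1)]] down.F.arr_map_hom[OF g])
  show "arr_map Down (g \<cdot>\<^bsub>D\<^esub> f) \<cdot>\<^bsub>D\<^esub> unit A =
      (arr_map Down g \<cdot>\<^bsub>D\<^esub> arr_map Down f) \<cdot>\<^bsub>D\<^esub> unit A"
    by (simp add: unit_natural[OF gf] comp_Down_comp_unit[OF f(1) down.F.arr_map_hom[OF g]]
        unit_natural[OF g] thunkable_assoc[OF f(2,1) g unit_hom[OF X]])
qed

text \<open>With the unit at \<open>A\<close> composed on the right, both sides become
  \<open>f\<close>: a counit cancels a unit at \<open>B\<close> on the left side and at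
  \<open>A\<close> on the right side.\<close>

lemma counit_natural:
  assumes f: "f \<in> hom D A B" "thunkable D f"
  shows "counit B \<cdot>\<^bsub>D\<^esub> arr_map Down f = f \<cdot>\<^bsub>D\<^esub> counit A"
proof (rule comp_unit_inj)
  show A: "A \<in> Obj D" using hom_Obj[OF f(1)] by auto
  have B: "B \<in> Obj D" using hom_Obj[OF f(1)] by auto
  show "counit B \<cdot>\<^bsub>D\<^esub> arr_map Down f \<in> hom D (obj_map Down A) B"
    by (rule comp_hom[OF down.F.arr_map_hom[OF f(1)] counit_hom[OF B]])
  show "f \<cdot>\<^bsub>D\<^esub> counit A \<in> hom D (obj_map Down A) B"
    by (rule comp_hom[OF counit_hom[OF A] f(1)])
  show "(counit B \<cdot>\<^bsub>D\<^esub> arr_map Down f) \<cdot>\<^bsub>D\<^esub> unit A = (f \<cdot>\<^bsub>D\<^esub> counit A) \<cdot>\<^bsub>D\<^esub> unit A"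
    using thunkable_assoc[OF unit_thunkable[OF A] unit_hom[OF A] counit_hom[OF A] f(1)]
    by (simp add: comp_Down_comp_unit[OF f(1) counit_hom[OF B]] counit_unit A B
        comp_ident_left[OF f(1)] comp_ident_right[OF f(1)])
qed

text \<open>Every map between negative objects is thunkable, so \<open>Down_thunkable\<close> and
  \<open>Down_comp\<close> apply to all of \<open>\<N>\<^sub>l D\<close>.\<close>

lemma Down_functor: "cat_functor (\<N>\<^sub>l D) (\<P>\<^sub>t D) Down"
proof -
  interpret N: category "\<N>\<^sub>l D" by (rule category_negative_linear)
  interpret P: category "\<P>\<^sub>t D" by (rule category_positive_thunkable)
  show ?thesis
    by unfold_locales
      (auto simp: hom_negative_linear hom_positive_thunkable negative_Obj down.positive_values
        down.F.arr_map_ident down.F.arr_map_hom Down_thunkable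
        intro: Down_comp negative_thunkable)
qed

text \<open>The inverse is composition with the unit. One round trip rebrackets by thunkability of
  \<open>f\<close>, the other by thunkability of \<open>h\<close>, whose target is negative.\<close>

lemma bij_betw_comp_counit:
  assumes P: "positive D P" and N: "negative D N"
  shows "bij_betw (\<lambda>f. counit N \<cdot>\<^bsub>D\<^esub> f) (hom (\<P>\<^sub>t D) P (obj_map Down N)) (hom D P N)"
proof (rule bij_betw_byWitness[where f' = "\<lambda>h. unit N \<cdot>\<^bsub>D\<^esub> h"])
  note N' = negative_Obj[OF N]
  note u = unit_hom[OF N'] and e = counit_hom[OF N']
  show "\<forall>f \<in> hom (\<P>\<^sub>t D) P (obj_map Down N). unit N \<cdot>\<^bsub>D\<^esub> (counit N \<cdot>\<^bsub>D\<^esub> f) = f"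
  proof
    fix f assume "f \<in> hom (\<P>\<^sub>t D) P (obj_map Down N)"
    then have f: "thunkable D f" "f \<in> hom D P (obj_map Down N)"
      by (simp_all add: hom_positive_thunkable)
    show "unit N \<cdot>\<^bsub>D\<^esub> (counit N \<cdot>\<^bsub>D\<^esub> f) = f"
      using thunkable_assoc[OF f e u] unit_counit[OF N'] comp_ident_left[OF f(2)] by simp
  qed
  show "\<forall>h \<in> hom D P N. counit N \<cdot>\<^bsub>D\<^esub> (unit N \<cdot>\<^bsub>D\<^esub> h) = h"
  proof
    fix h assume h: "h \<in> hom D P N"
    show "counit N \<cdot>\<^bsub>D\<^esub> (unit N \<cdot>\<^bsub>D\<^esub> h) = h"
      using thunkable_assoc[OF negative_thunkable[OF N h] h u e] counit_unit[OF N']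
        comp_ident_left[OF h] by simp
  qed
  show "(\<lambda>f. counit N \<cdot>\<^bsub>D\<^esub> f) ` hom (\<P>\<^sub>t D) P (obj_map Down N) \<subseteq> hom D P N"
    using comp_hom[OF _ e] by (auto simp: hom_positive_thunkable)
  show "(\<lambda>h. unit N \<cdot>\<^bsub>D\<^esub> h) ` hom D P N \<subseteq> hom (\<P>\<^sub>t D) P (obj_map Down N)"
    using comp_hom[OF _ u] P down.positive_values[OF N']
      thunkable_comp[OF negative_thunkable[OF N] _ unit_thunkable[OF N'] u]
    by (auto simp: hom_positive_thunkable)
qed

end

section \<open>The coadjunction bijection and its naturality\<close>

theorem proposition34:
  fixes C :: "('a, 'b) cat_data" and D :: "('o, 'm) cat_data"
    and Down Up :: "('o, 'm, 'o, 'm) graph_map" and \<delta> \<upsilon> :: "'o \<Rightarrow> 'o \<Rightarrow> 'm \<Rightarrow> 'm"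
    and F :: "('a, 'b, 'o, 'm) graph_map" and G :: "('o, 'm, 'a, 'b) graph_map"
    and \<phi> :: "'a \<Rightarrow> 'o \<Rightarrow> 'm \<Rightarrow> 'b"
  assumes "duploid D Down \<delta> Up \<upsilon>"
    and "category C"
    and "positive_adjunction C D F G \<phi>"
  shows "\<exists>\<psi>. relative_coadjunction (\<N>\<^sub>l D) (\<P>\<^sub>t D) Down C F G \<psi>"
proof -
  interpret duploid D Down \<delta> Up \<upsilon> by (rule assms(1))
  interpret C: category C by (rule assms(2))
  interpret A: positive_adjunction C D F G \<phi> by (rule assms(3))
  interpret CA: category_adjunction C D F G \<phi> ..
  interpret R: cat_functor "\<N>\<^sub>l D" "\<P>\<^sub>t D" Down by (rule Down_functor)
  interpret L: cat_functor C "\<P>\<^sub>t D" F by (rule CA.left_adjoint_functor[OF assms(3)])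
  interpret G: cat_functor "\<N>\<^sub>l D" C G by (rule CA.right_adjoint_functor)
  have "relative_coadjunction (\<N>\<^sub>l D) (\<P>\<^sub>t D) Down C F G (\<lambda>X N f. \<phi> X N (counit N \<cdot>\<^bsub>D\<^esub> f))"
  proof unfold_locales
    fix X N assume X: "X \<in> Obj C" and "N \<in> Obj (\<N>\<^sub>l D)"
    then have N: "negative D N" and N': "N \<in> Obj D" by (simp_all add: negative_Obj)
    note e = counit_hom[OF N']
    show "bij_betw (\<lambda>f. \<phi> X N (counit N \<cdot>\<^bsub>D\<^esub> f))
        (hom (\<P>\<^sub>t D) (obj_map F X) (obj_map Down N)) (hom C X (obj_map G N))"
      \<comment> \<open>Composition with the counit followed by \<open>\<phi>\<close>; positivity of
        \<open>obj_map F X\<close> places it among the objects of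
        \<open>\<P>\<^sub>t D\<close>.\<close>
      using bij_betw_trans[OF bij_betw_comp_counit[OF A.positive_values[OF X] N] A.bij[OF X N']]
      by (simp add: o_def)
    fix f assume "f \<in> hom (\<P>\<^sub>t D) (obj_map F X) (obj_map Down N)"
    then have f: "f \<in> hom D (obj_map F X) (obj_map Down N)" and tf: "thunkable D f"
      by (simp_all add: hom_positive_thunkable)
    {
      fix v M assume "v \<in> hom (\<N>\<^sub>l D) N M"
      then have v: "v \<in> hom D N M" and lin: "linear D v" and M: "negative D M"
        by (simp_all add: hom_negative_linear)
      \<comment> \<open>Thunkability of \<open>f\<close> brings the counit next to
        \<open>arr_map Down v\<close>, naturality of the counit moves it past \<open>v\<close>, and
        linearity of \<open>v\<close> restores the brackets so that target naturality of
        \<open>\<phi>\<close> applies.\<close>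
      have "counit M \<cdot>\<^bsub>D\<^esub> (arr_map Down v \<cdot>\<^bsub>D\<^esub> f) = (counit M \<cdot>\<^bsub>D\<^esub> arr_map Down v) \<cdot>\<^bsub>D\<^esub> f"
        by (rule thunkable_assoc[OF tf f down.F.arr_map_hom[OF v]
              counit_hom[OF negative_Obj[OF M]], symmetric])
      also have "\<dots> = v \<cdot>\<^bsub>D\<^esub> (counit N \<cdot>\<^bsub>D\<^esub> f)"
        by (simp add: counit_natural[OF v negative_thunkable[OF M v]]
            linear_assoc[OF lin f e v])
      finally show "\<phi> X M (counit M \<cdot>\<^bsub>D\<^esub> (arr_map Down v \<cdot>\<^bsub>\<P>\<^sub>t D\<^esub> f)) =
          arr_map G v \<cdot>\<^bsub>C\<^esub> \<phi> X N (counit N \<cdot>\<^bsub>D\<^esub> f)"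
        by (simp add: A.natural_target[OF X comp_hom[OF f e] v])
    next
      fix w X' assume w: "w \<in> hom C X' X"
      \<comment> \<open>The image of \<open>w\<close> under \<open>F\<close> is thunkable because
        \<open>C\<close> is associative, so it can be split off on the right before source
        naturality of \<open>\<phi>\<close> is used.\<close>
      show "\<phi> X' N (counit N \<cdot>\<^bsub>D\<^esub> (f \<cdot>\<^bsub>\<P>\<^sub>t D\<^esub> arr_map F w)) =
          \<phi> X N (counit N \<cdot>\<^bsub>D\<^esub> f) \<cdot>\<^bsub>C\<^esub> w"
        using A.natural_source[OF comp_hom[OF f e] w]
          thunkable_assoc[OF CA.left_adjoint_thunkable[OF w] A.F.arr_map_hom[OF w] f e]
        by simp
    }
  qed
  then show ?thesis by (intro exI)
qed

end
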